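(* Let $\mathcal{H}\neq\{0\}$ be a Hilbert space and let $T,A\in \mathcal{B}(\mathcal{H})$. For any $\varepsilon\in [0,1)$, $T\perp_B^\varepsilon A$ if and only if there is a sequence of unit vectors $(x_n)_{n\in \mathbb{N}}$ in $\mathcal{H}$ such that $$\lim_{n \to \infty} \|Tx_n\|= \|T\| \quad \text{and} \quad \lim_{n \to \infty}|\langle Tx_n, Ax_n\rangle|\le \varepsilon\|T\|\|A\|$$ (the second limit being required to exist).
   Context: All Hilbert spaces are complex and separable, and all operators are bounded and linear. For $\varepsilon\in[0,1)$ and elements $x,y$ of a normed space, $x\perp_B^\varepsilon y$ ($\varepsilon$-approximate Birkhoff-James orthogonality) means $\|x+\lambda y\|^2\ge\|x\|^2-2\varepsilon\|x\|\|\lambda y\|$ for all scalars $\lambda$. Here the normed space is $\mathcal{B}(\mathcal{H})$ with the operator norm and the scalars are complex. *)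

theory Defs
  imports "HOL-Analysis.Analysis"
begin

class scaleC =
  fixes scaleC :: "complex \<Rightarrow> 'a \<Rightarrow> 'a"  (infixr \<open>*\<^sub>C\<close> 75)

text \<open>A complex normed space is also a real normed space, by restriction of scalars, so that the
  norm, the topology and the notion of a bounded linear map are those of the real library.\<close>

class complex_normed_vector = real_normed_vector + scaleC +
  assumes scaleC_add_right: "a *\<^sub>C (x + y) = a *\<^sub>C x + a *\<^sub>C y"
    and scaleC_add_left: "(a + b) *\<^sub>C x = a *\<^sub>C x + b *\<^sub>C x"
    and scaleC_scaleC: "a *\<^sub>C b *\<^sub>C x = (a * b) *\<^sub>C x"
    and scaleR_scaleC: "r *\<^sub>R x = complex_of_real r *\<^sub>C x"
    and norm_scaleC: "norm (a *\<^sub>C x) = cmod a * norm x"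

text \<open>The inner product is linear in the first argument and conjugate-linear in the second.\<close>

class complex_inner = complex_normed_vector +
  fixes cinner :: "'a \<Rightarrow> 'a \<Rightarrow> complex"
  assumes cinner_commute: "cinner x y = cnj (cinner y x)"
    and cinner_add_left: "cinner (x + y) z = cinner x z + cinner y z"
    and cinner_scaleC_left: "cinner (a *\<^sub>C x) y = a * cinner x y"
    and cinner_self: "cinner x x = complex_of_real ((norm x)\<^sup>2)"

class chilbert_space = complex_inner + complete_space

instantiation complex :: chilbert_space
begin

definition scaleC_complex :: "complex \<Rightarrow> complex \<Rightarrow> complex"
  where "scaleC_complex a x = a * x"

definition cinner_complex :: "complex \<Rightarrow> complex \<Rightarrow> complex"
  where "cinner_complex x y = x * cnj y"

instance
  by standard
    (auto simp: scaleC_complex_def cinner_complex_def algebra_simps norm_mult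
       scaleR_conv_of_real complex_norm_square simp flip: of_real_power)

end

text \<open>The bounded complex-linear operators, with the operator norm.\<close>

typedef (overloaded) ('a, 'b) cblinfun =
  "{f :: 'a::complex_normed_vector \<Rightarrow> 'b::complex_normed_vector.
      bounded_linear f \<and> (\<forall>a x. f (a *\<^sub>C x) = a *\<^sub>C f x)}"
  morphisms cblinfun_apply CBlinfun
proof
  have "(0::'b) = a *\<^sub>C 0" for a
    using norm_scaleC[of a "0::'b"] by simp
  then show "(\<lambda>_. 0) \<in> {f :: 'a \<Rightarrow> 'b. bounded_linear f \<and> (\<forall>a x. f (a *\<^sub>C x) = a *\<^sub>C f x)}"
    by simp
qed

setup_lifting type_definition_cblinfun

lemma scaleC_zero_right: "a *\<^sub>C (0::'a::complex_normed_vector) = 0"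
  using norm_scaleC[of a "0::'a"] by simp

lemma scaleC_minus_right: "a *\<^sub>C (- x) = - (a *\<^sub>C (x::'a::complex_normed_vector))"
  by (metis add.right_inverse add_eq_0_iff scaleC_add_right scaleC_zero_right)

lemma scaleC_diff_right: "a *\<^sub>C (x - y) = a *\<^sub>C x - a *\<^sub>C (y::'a::complex_normed_vector)"
  by (metis diff_conv_add_uminus scaleC_add_right scaleC_minus_right)

lemma scaleC_scaleR: "a *\<^sub>C r *\<^sub>R x = r *\<^sub>R a *\<^sub>C (x::'a::complex_normed_vector)"
  by (simp add: scaleR_scaleC scaleC_scaleC mult.commute)

lemma bounded_linear_scaleC_right:
  "bounded_linear (\<lambda>x. a *\<^sub>C (x::'a::complex_normed_vector))"
  by (rule bounded_linear_intro[where K = "cmod a"])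
    (simp_all add: scaleC_add_right scaleC_scaleR norm_scaleC)

lemma onorm_scaleC:
  fixes f :: "'a::real_normed_vector \<Rightarrow> 'b::complex_normed_vector"
  assumes "bounded_linear f"
  shows "onorm (\<lambda>x. a *\<^sub>C f x) = cmod a * onorm f"
proof -
  have "onorm (\<lambda>x. a *\<^sub>C f x) = onorm (\<lambda>x. cmod a *\<^sub>R f x)"
    by (simp add: onorm_def norm_scaleC)
  then show ?thesis
    by (simp add: onorm_scaleR[OF assms])
qed

instantiation cblinfun :: (complex_normed_vector, complex_normed_vector) complex_normed_vector
begin

lift_definition norm_cblinfun :: "('a, 'b) cblinfun \<Rightarrow> real" is onorm .

lift_definition zero_cblinfun :: "('a, 'b) cblinfun" is "\<lambda>x. 0"
  by (simp add: scaleC_zero_right)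

lift_definition plus_cblinfun :: "('a, 'b) cblinfun \<Rightarrow> ('a, 'b) cblinfun \<Rightarrow> ('a, 'b) cblinfun"
  is "\<lambda>f g x. f x + g x"
  by (simp add: bounded_linear_add scaleC_add_right)

lift_definition minus_cblinfun :: "('a, 'b) cblinfun \<Rightarrow> ('a, 'b) cblinfun \<Rightarrow> ('a, 'b) cblinfun"
  is "\<lambda>f g x. f x - g x"
  by (simp add: bounded_linear_sub scaleC_diff_right)

lift_definition uminus_cblinfun :: "('a, 'b) cblinfun \<Rightarrow> ('a, 'b) cblinfun"
  is "\<lambda>f x. - f x"
  by (simp add: bounded_linear_minus scaleC_minus_right)

lift_definition scaleR_cblinfun :: "real \<Rightarrow> ('a, 'b) cblinfun \<Rightarrow> ('a, 'b) cblinfun"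
  is "\<lambda>r f x. r *\<^sub>R f x"
  by (simp add: bounded_linear_const_scaleR scaleC_scaleR)

lift_definition scaleC_cblinfun :: "complex \<Rightarrow> ('a, 'b) cblinfun \<Rightarrow> ('a, 'b) cblinfun"
  is "\<lambda>c f x. c *\<^sub>C f x"
  by (simp add: bounded_linear_compose[OF bounded_linear_scaleC_right] scaleC_scaleC mult.commute)

definition dist_cblinfun :: "('a, 'b) cblinfun \<Rightarrow> ('a, 'b) cblinfun \<Rightarrow> real"
  where "dist_cblinfun f g = norm (f - g)"

definition sgn_cblinfun :: "('a, 'b) cblinfun \<Rightarrow> ('a, 'b) cblinfun"
  where "sgn_cblinfun f = scaleR (inverse (norm f)) f"

definition uniformity_cblinfun :: "(('a, 'b) cblinfun \<times> ('a, 'b) cblinfun) filter"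
  where "uniformity_cblinfun = (INF e\<in>{0<..}. principal {(f, g). dist f g < e})"

definition open_cblinfun :: "('a, 'b) cblinfun set \<Rightarrow> bool"
  where "open_cblinfun S \<longleftrightarrow> (\<forall>f\<in>S. \<forall>\<^sub>F (f', g) in uniformity. f' = f \<longrightarrow> g \<in> S)"

instance
proof
  fix f g h :: "('a, 'b) cblinfun" and r s :: real and a b :: complex
  show "dist f g = norm (f - g)" by (rule dist_cblinfun_def)
  show "sgn f = inverse (norm f) *\<^sub>R f" by (rule sgn_cblinfun_def)
  show "(uniformity :: (('a, 'b) cblinfun \<times> ('a, 'b) cblinfun) filter) =
      (INF e\<in>{0<..}. principal {(f, g). dist f g < e})"
    by (rule uniformity_cblinfun_def)
  show "open S \<longleftrightarrow> (\<forall>f\<in>S. \<forall>\<^sub>F (f', g) in uniformity. f' = f \<longrightarrow> g \<in> S)"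
    for S :: "('a, 'b) cblinfun set"
    by (rule open_cblinfun_def)
  show "f + g + h = f + (g + h)" by transfer (simp add: add.assoc)
  show "f + g = g + f" by transfer (simp add: add.commute)
  show "0 + f = f" by transfer simp
  show "- f + f = 0" by transfer simp
  show "f - g = f + - g" by transfer simp
  show "r *\<^sub>R (f + g) = r *\<^sub>R f + r *\<^sub>R g" by transfer (simp add: scaleR_add_right)
  show "(r + s) *\<^sub>R f = r *\<^sub>R f + s *\<^sub>R f" by transfer (simp add: scaleR_add_left)
  show "r *\<^sub>R s *\<^sub>R f = (r * s) *\<^sub>R f" by transfer simp
  show "1 *\<^sub>R f = f" by transfer simp
  show "norm f = 0 \<longleftrightarrow> f = 0" by transfer (auto simp: onorm_eq_0)
  show "norm (f + g) \<le> norm f + norm g" by transfer (simp add: onorm_triangle)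
  show "norm (r *\<^sub>R f) = \<bar>r\<bar> * norm f" by transfer (simp add: onorm_scaleR)
  show "a *\<^sub>C (f + g) = a *\<^sub>C f + a *\<^sub>C g" by transfer (simp add: scaleC_add_right)
  show "(a + b) *\<^sub>C f = a *\<^sub>C f + b *\<^sub>C f" by transfer (simp add: scaleC_add_left)
  show "a *\<^sub>C b *\<^sub>C f = (a * b) *\<^sub>C f" by transfer (simp add: scaleC_scaleC)
  show "r *\<^sub>R f = complex_of_real r *\<^sub>C f" by transfer (simp add: scaleR_scaleC)
  show "norm (a *\<^sub>C f) = cmod a * norm f" by transfer (simp add: onorm_scaleC)
qed

end

definition approx_BJ_orthogonal :: "real \<Rightarrow> 'a::complex_normed_vector \<Rightarrow> 'a \<Rightarrow> bool"
  where "approx_BJ_orthogonal \<epsilon> x y \<longleftrightarrow>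
    (\<forall>c::complex. (norm (x + c *\<^sub>C y))\<^sup>2 \<ge> (norm x)\<^sup>2 - 2 * \<epsilon> * norm x * norm (c *\<^sub>C y))"

end

theory Submission
  imports Defs
begin

text \<open>Write \<open>f(x) = \<langle>Tx, Ax\<rangle>\<close>, \<open>M = \<parallel>T\<parallel> \<parallel>A\<parallel>\<close> and \<open>r = \<epsilon> M\<close>. If a sequence as in the theorem exists, then
  expanding \<open>\<parallel>(T + cA)x\<^sub>n\<parallel>\<^sup>2\<close>, dropping its last term and letting \<open>n\<close> tend to infinity gives
  approximate orthogonality.

  For the converse it is enough to find, for every \<open>d > 0\<close>, a unit vector that almost attains
  \<open>\<parallel>T\<parallel>\<close> (within \<open>d\<close>) and satisfies \<open>\<bar>f(x)\<bar> \<le> r + d\<close>: a subsequence then makes \<open>\<bar>f(x\<^sub>n)\<bar>\<close> converge.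
  Testing orthogonality with a small multiple of \<open>A\<close> in one complex direction only yields, for each
  phase \<open>u\<close>, an almost maximal unit vector \<open>y\<close> with \<open>Re (u f(y)) \<le> r + d\<close>
  (\<open>approx_BJ_orthogonal_ex_near_maximal_Re_le\<close>). The classical way to a single vector that is
  good for all phases is to separate a disc from the set of limits of \<open>f\<close> along almost maximal
  sequences, which is compact and, by a Toeplitz--Hausdorff argument, convex.

  Here the separation and the convexity are merged into one descent step
  (\<open>numerical_value_descent\<close>). Let \<open>x\<close> be almost maximal with \<open>\<bar>f(x)\<bar>\<close> well above \<open>r\<close>, let \<open>u\<close> be
  the phase with \<open>u f(x) = \<bar>f(x)\<bar>\<close>, and let \<open>y\<close> be the vector supplied for \<open>u\<close>. As in the proof of
  the Toeplitz--Hausdorff theorem, the phase \<open>w\<close> in \<open>v = x + t w y\<close> can be chosen so that the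
  first-order term in \<open>t\<close> is real, and its sign so that this term does not hurt; the second-order
  term then pulls \<open>\<bar>f(v)\<bar> / \<parallel>v\<parallel>\<^sup>2\<close> down by an amount that depends only on \<open>M\<close> and on the gap. Being
  almost maximal survives, because the form \<open>\<parallel>T\<parallel>\<^sup>2\<parallel>x\<parallel>\<^sup>2 - \<parallel>Tx\<parallel>\<^sup>2\<close> is positive semidefinite, so that its
  square root is a seminorm. Since \<open>\<bar>f\<bar>\<close> cannot decrease by a fixed amount forever, some almost
  maximal vector has \<open>\<bar>f(x)\<bar> \<le> r + d\<close>.\<close>

section \<open>Inner products and operators\<close>

lemma cinner_add_right: "cinner x (y + z) = cinner x y + cinner x (z::'a::complex_inner)"
  by (metis cinner_commute cinner_add_left complex_cnj_add)

lemma cinner_scaleC_right: "cinner x (c *\<^sub>C y) = cnj c * cinner x (y::'a::complex_inner)"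
  by (metis cinner_commute cinner_scaleC_left complex_cnj_mult)

lemma cinner_sesquilinear_expand:
  fixes a b c d :: "'a::complex_inner"
  shows "cinner (a + s *\<^sub>C b) (c + s *\<^sub>C d)
    = cinner a c + (s * cinner b c + cnj s * cinner a d) + (cmod s)\<^sup>2 * cinner b d"
  by (simp add: cinner_add_left cinner_add_right cinner_scaleC_left cinner_scaleC_right
      complex_norm_square algebra_simps del: of_real_power)

lemma norm_add_scaleC_sq:
  fixes a b :: "'a::complex_inner"
  shows "(norm (a + s *\<^sub>C b))\<^sup>2
    = (norm a)\<^sup>2 + 2 * Re (cnj s * cinner a b) + (cmod s)\<^sup>2 * (norm b)\<^sup>2"
proof -
  have "s * cinner b a = cnj (cnj s * cinner a b)"
    by (metis cinner_commute complex_cnj_cnj complex_cnj_mult)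
  then have "Re (s * cinner b a) = Re (cnj s * cinner a b)"
    by (metis Re_complex_of_real complex_cnj_cnj complex.sel(1) cnj.simps(1))
  moreover have "complex_of_real ((norm (a + s *\<^sub>C b))\<^sup>2) = complex_of_real ((norm a)\<^sup>2)
      + (s * cinner b a + cnj s * cinner a b) + (cmod s)\<^sup>2 * complex_of_real ((norm b)\<^sup>2)"
    by (simp only: cinner_self[symmetric] cinner_sesquilinear_expand)
  then have "(norm (a + s *\<^sub>C b))\<^sup>2 = (norm a)\<^sup>2
      + (Re (s * cinner b a) + Re (cnj s * cinner a b)) + (cmod s)\<^sup>2 * (norm b)\<^sup>2"
    by (metis (no_types) Re_complex_of_real of_real_mult plus_complex.simps(1))
  ultimately show ?thesis by simp
qed

lemma scaleC_one_left: "1 *\<^sub>C (x::'a::complex_normed_vector) = x"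
  by (metis of_real_1 scaleR_one scaleR_scaleC)

text \<open>Cauchy--Schwarz, from the nonnegative squared norm of the component of \<open>x\<close> orthogonal to \<open>y\<close>.\<close>

lemma cmod_cinner_le_norm: "cmod (cinner x y) \<le> norm x * norm (y::'a::complex_inner)"
proof (cases "norm y = 0")
  case True
  then have "y = 0 *\<^sub>C y"
    by (simp add: scaleC_zero_right)
  then have "cinner x y = 0"
    by (metis cinner_scaleC_right complex_cnj_zero mult_zero_left)
  then show ?thesis by simp
next
  case False
  define c where "c = cinner x y"
  define n where "n = (norm y)\<^sup>2"
  have n: "n > 0" using False by (simp add: n_def)
  define s where "s = - (c / complex_of_real n)"
  have "cnj s * c = complex_of_real (- ((cmod c)\<^sup>2 / n))"
    using n by (simp add: s_def mult.commute flip: complex_norm_square)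
  moreover have "(cmod s)\<^sup>2 * n = (cmod c)\<^sup>2 / n"
    using n by (simp add: s_def norm_divide power_divide power2_eq_square)
  moreover have "0 \<le> (norm (x + s *\<^sub>C y))\<^sup>2" by simp
  ultimately have "(cmod c)\<^sup>2 / n \<le> (norm x)\<^sup>2"
    unfolding norm_add_scaleC_sq n_def[symmetric] c_def[symmetric] by simp
  then have "(cmod c)\<^sup>2 \<le> (norm x * norm y)\<^sup>2"
    using n by (simp add: pos_divide_le_eq power_mult_distrib n_def)
  then show ?thesis
    unfolding c_def by (rule power2_le_imp_le) simp
qed

lemma bounded_linear_cblinfun_apply: "bounded_linear (cblinfun_apply T)"
  using cblinfun_apply[of T] by simp

lemma cblinfun_apply_scaleC: "cblinfun_apply T (c *\<^sub>C x) = c *\<^sub>C cblinfun_apply T x"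
  using cblinfun_apply[of T] by simp

lemmas cblinfun_apply_add = bounded_linear_cblinfun_apply[THEN linear_simps(1)]
lemmas cblinfun_apply_scaleR = bounded_linear_cblinfun_apply[THEN linear_simps(5)]

lemma norm_cblinfun_apply: "norm (cblinfun_apply T x) \<le> norm T * norm x"
  unfolding norm_cblinfun.rep_eq by (rule onorm[OF bounded_linear_cblinfun_apply])

lemma cmod_cinner_cblinfun_le:
  fixes T A :: "('a::complex_normed_vector, 'b::complex_inner) cblinfun"
  shows "cmod (cinner (cblinfun_apply T x) (cblinfun_apply A y))
    \<le> norm T * norm A * (norm x * norm y)"
proof -
  have "cmod (cinner (cblinfun_apply T x) (cblinfun_apply A y))
      \<le> norm (cblinfun_apply T x) * norm (cblinfun_apply A y)"
    by (rule cmod_cinner_le_norm)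
  also have "\<dots> \<le> (norm T * norm x) * (norm A * norm y)"
    by (intro mult_mono norm_cblinfun_apply) auto
  finally show ?thesis by (simp add: mult_ac)
qed

text \<open>The squares are kept because it is \<open>\<parallel>Sx\<parallel>\<^sup>2\<close> that expands for \<open>S = T + cA\<close>. In the zero space
  the lemma would fail, for lack of unit vectors.\<close>

lemma ex_unit_vector_norm_sq_gt:
  fixes S :: "('a::complex_normed_vector, 'b::complex_normed_vector) cblinfun"
  assumes nonzero: "(UNIV :: 'a set) \<noteq> {0}" and "d > 0"
  shows "\<exists>x. norm x = 1 \<and> (norm (cblinfun_apply S x))\<^sup>2 > (norm S)\<^sup>2 - d"
proof (rule ccontr)
  assume "\<not> ?thesis"
  then have le: "(norm (cblinfun_apply S x))\<^sup>2 \<le> (norm S)\<^sup>2 - d" if "norm x = 1" for x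
    using that by (meson not_less)
  obtain e :: 'a where "e \<noteq> 0"
    using nonzero by auto
  then have "norm (sgn e) = 1"
    by (simp add: norm_sgn)
  from le[OF this] have nn: "0 \<le> (norm S)\<^sup>2 - d"
    by (meson order_trans zero_le_power2)
  have "norm (cblinfun_apply S x) \<le> sqrt ((norm S)\<^sup>2 - d) * norm x" for x
  proof (cases "x = 0")
    case False
    have "norm (cblinfun_apply S (sgn x)) \<le> sqrt ((norm S)\<^sup>2 - d)"
      using le[of "sgn x"] False by (simp add: norm_sgn real_le_rsqrt)
    then show ?thesis
      using False by (simp add: sgn_div_norm cblinfun_apply_scaleR field_simps)
  qed (simp add: bounded_linear_cblinfun_apply[THEN linear_simps(3)])
  then have "onorm (cblinfun_apply S) \<le> sqrt ((norm S)\<^sup>2 - d)"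
    using nn by (intro onorm_bound) auto
  then have "norm S \<le> sqrt ((norm S)\<^sup>2 - d)"
    by (simp only: norm_cblinfun.rep_eq)
  then have "(norm S)\<^sup>2 \<le> (norm S)\<^sup>2 - d"
    using nn by (metis norm_ge_zero power_mono real_sqrt_pow2)
  with \<open>d > 0\<close> show False by simp
qed

section \<open>The defect form\<close>

text \<open>The quadratic form of \<open>\<parallel>T\<parallel>\<^sup>2 - T\<^sup>*T\<close>. On unit vectors, a small defect means that \<open>\<parallel>Tx\<parallel>\<close> is close
  to \<open>\<parallel>T\<parallel>\<close>; unlike that condition, it behaves well under linear combinations.\<close>

definition norm_defect :: "('a::complex_normed_vector, 'b::complex_normed_vector) cblinfun \<Rightarrow> 'a \<Rightarrow> real"
  where "norm_defect T x = (norm T)\<^sup>2 * (norm x)\<^sup>2 - (norm (cblinfun_apply T x))\<^sup>2"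

lemma norm_defect_nonneg: "0 \<le> norm_defect T x"
  using power_mono[OF norm_cblinfun_apply[of T x], of 2]
  by (simp add: norm_defect_def power_mult_distrib)

lemma norm_defect_scaleC: "norm_defect T (c *\<^sub>C x) = (cmod c)\<^sup>2 * norm_defect T x"
  by (simp add: norm_defect_def cblinfun_apply_scaleC norm_scaleC power_mult_distrib algebra_simps)

text \<open>Like every quadratic form the defect satisfies the parallelogram law, in which the term of
  \<open>x - y\<close> may be dropped because it is nonnegative.\<close>

lemma norm_defect_add_le:
  fixes T :: "('a::complex_inner, 'b::complex_inner) cblinfun"
  shows "norm_defect T (x + y) \<le> 2 * norm_defect T x + 2 * norm_defect T y"
proof -
  have par: "(norm (a + b))\<^sup>2 + (norm (a + (- 1) *\<^sub>C b))\<^sup>2 = 2 * (norm a)\<^sup>2 + 2 * (norm b)\<^sup>2"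
    for a b :: "'c::complex_inner"
    using norm_add_scaleC_sq[of a 1 b] norm_add_scaleC_sq[of a "- 1" b]
    by (simp add: scaleC_one_left)
  have "(norm T)\<^sup>2 * ((norm (x + y))\<^sup>2 + (norm (x + (- 1) *\<^sub>C y))\<^sup>2)
      = (norm T)\<^sup>2 * (2 * (norm x)\<^sup>2 + 2 * (norm y)\<^sup>2)"
    by (simp only: par)
  then have "norm_defect T (x + y) + norm_defect T (x + (- 1) *\<^sub>C y)
      = 2 * norm_defect T x + 2 * norm_defect T y"
    using par[of "cblinfun_apply T x" "cblinfun_apply T y"]
    by (simp add: norm_defect_def cblinfun_apply_add cblinfun_apply_scaleC algebra_simps)
  then show ?thesis
    using norm_defect_nonneg[of T "x + (- 1) *\<^sub>C y"] by linarith
qed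

section \<open>Lowering the numerical value near the norm\<close>

lemma cnj_sgn_mult_self: "cnj (sgn z) * z = complex_of_real (cmod z)"
proof (cases "z = 0")
  case False
  have "cnj z * z = complex_of_real (cmod z) * complex_of_real (cmod z)"
    by (metis complex_norm_square mult.commute of_real_power power2_eq_square)
  then show ?thesis
    using False by (simp add: sgn_eq)
qed simp

text \<open>The phase choice of the Toeplitz--Hausdorff theorem. The imaginary part is that of
  \<open>w (p - cnj q)\<close>, so it vanishes for some pair of opposite values of \<open>w\<close>; these give the real part
  opposite signs.\<close>

lemma ex_unit_cross_term_nonpos:
  fixes p q :: complex
  shows "\<exists>w. cmod w = 1 \<and> Im (w * p + cnj w * q) = 0 \<and> Re (w * p + cnj w * q) \<le> 0"
proof -
  define d where "d = p - cnj q"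
  define w where "w = (if d = 0 then 1 else cnj (sgn d))"
  have w: "cmod w = 1"
    by (simp add: w_def norm_sgn)
  have "w * d = complex_of_real (cmod d)"
    by (simp add: w_def cnj_sgn_mult_self)
  then have "Im (w * d) = 0" by simp
  then have im: "Im (w * p + cnj w * q) = 0"
    by (simp add: d_def algebra_simps)
  show ?thesis
  proof (cases "Re (w * p + cnj w * q) \<le> 0")
    case False
    then show ?thesis using w im by (intro exI[of _ "- w"]) (simp add: algebra_simps)
  qed (use w im in blast)
qed

text \<open>Put \<open>a = \<bar>f(x, x)\<bar>\<close>, \<open>v = x + t w y\<close> and \<open>N = \<parallel>v\<parallel>\<^sup>2\<close>. Then
  \<open>u f(v, v) = a N + t C + t\<^sup>2 (u f(y, y) - a)\<close>, where the phase \<open>w\<close> makes \<open>C\<close> real and nonpositive.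
  The real part is therefore lower than \<open>a N\<close> by at least \<open>t\<^sup>2\<eta>\<close>, while the imaginary part is of order
  \<open>t\<^sup>2\<close> and enters the modulus only through its square, of order \<open>t\<^sup>4\<close>. Hence a small \<open>t\<close> wins.
  The gain is explicit and independent of \<open>\<delta>\<close>, so that the step can be repeated.\<close>

lemma numerical_value_descent:
  fixes T A :: "('a::complex_inner, 'b::complex_inner) cblinfun"
  defines "f \<equiv> \<lambda>x y. cinner (cblinfun_apply T x) (cblinfun_apply A y)"
  assumes unit: "norm x = 1" "norm y = 1"
    and def: "norm_defect T x \<le> \<delta>" "norm_defect T y \<le> \<delta>"
    and u: "cmod u = 1" "u * f x x = complex_of_real (cmod (f x x))"
    and eta: "0 < \<eta>" "\<eta> \<le> cmod (f x x)" "Re (u * f y y) \<le> cmod (f x x) - \<eta>"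
    and M: "M = norm T * norm A"
  shows "\<exists>v. norm v = 1 \<and> norm_defect T v \<le> 16 * \<delta> \<and>
    (cmod (f v v))\<^sup>2 \<le> (cmod (f x x))\<^sup>2 - \<eta> ^ 4 / (1000 * M\<^sup>2)"
proof -
  define a where "a = cmod (f x x)"
  have fM: "cmod (f z z') \<le> M" if "norm z = 1" "norm z' = 1" for z z'
    using cmod_cinner_cblinfun_le[of T z A z'] that by (simp add: f_def M)
  have aM: "a \<le> M" and ea: "\<eta> \<le> a" and a0: "0 < a"
    using fM[OF unit(1) unit(1)] eta by (auto simp: a_def)
  then have M0: "0 < M" by linarith
  \<comment> \<open>Small enough for the real part of \<open>u f(v, v)\<close> to stay nonnegative, and for \<open>(t\<^sup>2 M)\<^sup>2\<close>,
    which equals \<open>t\<^sup>2\<eta>\<^sup>2 / 400\<close>, to be dominated by the gain of about \<open>t\<^sup>2\<eta>\<^sup>2\<close>.\<close>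
  define t where "t = \<eta> / (20 * M)"
  have t0: "0 < t" and t1: "t \<le> 1 / 20" and tM: "20 * t * M = \<eta>"
    using eta(1) ea aM M0 by (auto simp: t_def field_simps)
  obtain w where w: "cmod w = 1"
    and wIm: "Im (w * (u * f y x - a * cinner y x) + cnj w * (u * f x y - a * cinner x y)) = 0"
    and wRe: "Re (w * (u * f y x - a * cinner y x) + cnj w * (u * f x y - a * cinner x y)) \<le> 0"
    using ex_unit_cross_term_nonpos by blast
  define C where "C = w * (u * f y x - a * cinner y x) + cnj w * (u * f x y - a * cinner x y)"
  define s where "s = complex_of_real t * w"
  have s: "cmod s = t" using w t0 by (simp add: s_def norm_mult)
  define v where "v = x + s *\<^sub>C y"
  have ns: "norm (s *\<^sub>C y) = t" by (simp add: norm_scaleC s unit)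
  have nv: "1 / 2 \<le> norm v" "norm v \<le> 3 / 2"
    using norm_triangle_ineq[of x "s *\<^sub>C y"] norm_diff_ineq[of x "s *\<^sub>C y"] t1 ns unit
    by (auto simp: v_def)
  define N where "N = (norm v)\<^sup>2"
  have N: "1 / 4 \<le> N" "N \<le> 9 / 4"
    using power_mono[OF nv(1), of 2] power_mono[OF nv(2), of 2]
    by (auto simp: N_def power2_eq_square)
  have fv: "f v v = f x x + (s * f y x + cnj s * f x y) + t\<^sup>2 * f y y"
    unfolding f_def v_def cblinfun_apply_add cblinfun_apply_scaleC cinner_sesquilinear_expand s by simp
  have vv: "complex_of_real N = 1 + (s * cinner y x + cnj s * cinner x y) + t\<^sup>2"
    unfolding N_def cinner_self[symmetric] v_def cinner_sesquilinear_expand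
    by (simp add: cinner_self unit s)
  have key: "u * f v v = complex_of_real a * complex_of_real N + t * C + t\<^sup>2 * (u * f y y - a)"
    unfolding fv vv C_def s_def using u(2)[folded a_def]
    by (simp add: algebra_simps)
  have C: "C = complex_of_real (Re C)" using wIm by (simp add: C_def complex_eq_iff)
  have Cn: "cmod C \<le> 4 * M"
  proof -
    have c: "cmod (cinner x y) \<le> 1" "cmod (cinner y x) \<le> 1"
      using cmod_cinner_le_norm[of x y] cmod_cinner_le_norm[of y x] unit by auto
    have b: "cmod (w' * (u * z - a * z')) \<le> 2 * M" if "cmod w' = 1" "cmod z \<le> M" "cmod z' \<le> 1"
      for w' z z' :: complex
    proof -
      have "cmod (w' * (u * z - a * z')) = cmod (u * z - a * z')"
        by (simp add: norm_mult that(1))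
      also have "\<dots> \<le> cmod (u * z) + cmod (a * z')" by (rule norm_triangle_ineq4)
      also have "\<dots> = cmod z + a * cmod z'" using a0 u(1) by (simp add: norm_mult)
      also have "\<dots> \<le> M + M * 1" using that aM a0 by (intro add_mono mult_mono) auto
      finally show ?thesis by simp
    qed
    have "cmod (w * (u * f y x - a * cinner y x)) \<le> 2 * M"
      by (rule b) (simp_all add: w c fM unit)
    moreover have "cmod (cnj w * (u * f x y - a * cinner x y)) \<le> 2 * M"
      by (rule b) (simp_all add: w c fM unit)
    ultimately have "cmod C \<le> 2 * M + 2 * M"
      unfolding C_def by (intro norm_triangle_le add_mono)
    then show ?thesis by simp
  qed
  have Cb: "Re C \<le> 0" "- (4 * M) \<le> Re C"
    using wRe Cn abs_Re_le_cmod[of C] by (auto simp: C_def)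
  define g where "g = u * f y y"
  have "cmod g \<le> M" using fM[OF unit(2) unit(2)] u(1) by (simp add: g_def norm_mult)
  then have g: "- M \<le> Re g" "\<bar>Im g\<bar> \<le> M"
    using abs_Re_le_cmod[of g] abs_Im_le_cmod[of g] by linarith+
  define h where "h = - (t * Re C + t\<^sup>2 * (Re g - a))"
  have h_lower: "t\<^sup>2 * \<eta> \<le> h"
  proof -
    have "t\<^sup>2 * \<eta> \<le> t\<^sup>2 * (a - Re g)"
      using eta(3) by (intro mult_left_mono) (auto simp: a_def g_def)
    moreover have "t * Re C \<le> 0" using t0 Cb by (simp add: mult_nonneg_nonpos)
    ultimately show ?thesis by (simp add: h_def algebra_simps)
  qed
  have h_upper: "h \<le> a * N"
  proof -
    have "t * (- Re C) \<le> t * (4 * M)" using t0 Cb by (intro mult_left_mono) auto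
    moreover have "t\<^sup>2 * (a - Re g) \<le> (t * (1 / 20)) * (2 * M)"
      unfolding power2_eq_square
      using t0 t1 g aM eta by (intro mult_mono) (auto simp: a_def g_def)
    moreover have "0 < t * M" using t0 M0 by simp
    ultimately have "h \<le> 5 * t * M"
      by (simp add: h_def algebra_simps)
    also have "\<dots> \<le> a * (1 / 4)" using tM ea by simp
    also have "\<dots> \<le> a * N" using N a0 by (intro mult_left_mono) auto
    finally show ?thesis .
  qed
  \<comment> \<open>\<open>h\<close> is the drop of the real part; as it stays below \<open>a N\<close>, it cannot overshoot zero
    and enlarge the modulus.\<close>
  have re: "Re (u * f v v) = a * N - h" and im: "Im (u * f v v) = t\<^sup>2 * Im g"
    unfolding key g_def[symmetric] h_def
    using wIm[folded C_def] by (simp_all add: power2_eq_square algebra_simps)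
  have "(cmod (f v v))\<^sup>2 = (cmod (u * f v v))\<^sup>2" by (simp add: norm_mult u)
  also have "\<dots> = (a * N - h)\<^sup>2 + (t\<^sup>2 * Im g)\<^sup>2" by (simp only: cmod_power2 re im)
  also have "\<dots> \<le> (a * N)\<^sup>2 - a * N * h + (t\<^sup>2 * M)\<^sup>2"
  proof (intro add_mono)
    have "0 \<le> h" using h_lower eta(1) by (meson order_trans mult_nonneg_nonneg zero_le_power2 less_imp_le)
    then have "h * h \<le> a * N * h" using h_upper by (intro mult_right_mono)
    then show "(a * N - h)\<^sup>2 \<le> (a * N)\<^sup>2 - a * N * h"
      by (simp add: power2_eq_square algebra_simps)
    have "\<bar>t\<^sup>2 * Im g\<bar> \<le> \<bar>t\<^sup>2 * M\<bar>"
      using g M0 by (simp add: abs_mult mult_left_mono)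
    then show "(t\<^sup>2 * Im g)\<^sup>2 \<le> (t\<^sup>2 * M)\<^sup>2" by (rule abs_le_square_iff[THEN iffD1])
  qed
  also have "\<dots> \<le> (a\<^sup>2 - 2 / 5 * t\<^sup>2 * \<eta>\<^sup>2) * N\<^sup>2"
  proof -
    have "\<eta> * N * (t\<^sup>2 * \<eta>) \<le> a * N * h"
      using h_lower ea a0 N t0 eta(1) by (intro mult_mono) auto
    moreover have "N * (4 / 9 * N) \<le> N * 1" using N by (intro mult_left_mono) auto
    then have "(4 / 9 * N\<^sup>2) * (t\<^sup>2 * \<eta>\<^sup>2) \<le> N * (t\<^sup>2 * \<eta>\<^sup>2)"
      by (intro mult_right_mono) (auto simp: power2_eq_square)
    moreover have "(t\<^sup>2 * M)\<^sup>2 \<le> 1 / 25 * (t\<^sup>2 * \<eta>\<^sup>2) * N\<^sup>2"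
    proof -
      have "(1 / 4)\<^sup>2 \<le> N\<^sup>2" using N by (intro power_mono) auto
      then have "1 / 25 * (t\<^sup>2 * \<eta>\<^sup>2) * (1 / 4)\<^sup>2 \<le> 1 / 25 * (t\<^sup>2 * \<eta>\<^sup>2) * N\<^sup>2"
        by (intro mult_left_mono) auto
      moreover have "1 / 25 * (t\<^sup>2 * \<eta>\<^sup>2) * (1 / 4)\<^sup>2 = (t\<^sup>2 * M)\<^sup>2"
        unfolding tM[symmetric] by (simp add: power2_eq_square)
      ultimately show ?thesis by simp
    qed
    moreover have "0 \<le> N\<^sup>2 * (t\<^sup>2 * \<eta>\<^sup>2)" by simp
    ultimately show ?thesis
      by (simp add: power2_eq_square algebra_simps)
  qed
  finally have fin: "(cmod (f v v))\<^sup>2 \<le> (a\<^sup>2 - 2 / 5 * t\<^sup>2 * \<eta>\<^sup>2) * N\<^sup>2" .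
  define k where "k = complex_of_real (1 / norm v)"
  have k: "cmod k = 1 / norm v" using nv by (simp add: k_def norm_divide)
  have k2: "(cmod k)\<^sup>2 = 1 / N" by (simp add: k N_def power_divide)
  have "norm (k *\<^sub>C v) = 1" using nv by (auto simp add: norm_scaleC k)
  moreover have "norm_defect T (k *\<^sub>C v) \<le> 16 * \<delta>"
  proof -
    have "0 \<le> \<delta>" using def(1) norm_defect_nonneg order_trans by blast
    have "norm_defect T v \<le> 2 * norm_defect T x + 2 * norm_defect T (s *\<^sub>C y)"
      unfolding v_def by (rule norm_defect_add_le)
    also have "\<dots> \<le> 2 * \<delta> + 2 * (1 * \<delta>)"
      unfolding norm_defect_scaleC s using t0 t1 def norm_defect_nonneg[of T y]
      by (intro add_mono mult_left_mono mult_mono) (auto simp: power_le_one)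
    finally have "norm_defect T v \<le> 4 * \<delta>" by simp
    moreover have "1 / N \<le> 4" using N by (simp add: field_simps)
    ultimately have "1 / N * norm_defect T v \<le> 4 * (4 * \<delta>)"
      using N \<open>0 \<le> \<delta>\<close> norm_defect_nonneg[of T v] by (intro mult_mono) auto
    then show ?thesis by (simp add: norm_defect_scaleC k2)
  qed
  moreover have "(cmod (f (k *\<^sub>C v) (k *\<^sub>C v)))\<^sup>2 \<le> a\<^sup>2 - \<eta> ^ 4 / (1000 * M\<^sup>2)"
  proof -
    have "cmod (f (k *\<^sub>C v) (k *\<^sub>C v)) = (cmod k)\<^sup>2 * cmod (f v v)"
      by (simp add: f_def cblinfun_apply_scaleC cinner_scaleC_left cinner_scaleC_right norm_mult
          power2_eq_square)
    then have "(cmod (f (k *\<^sub>C v) (k *\<^sub>C v)))\<^sup>2 = (cmod (f v v))\<^sup>2 / N\<^sup>2"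
      by (simp add: k2 power_divide)
    also have "\<dots> \<le> a\<^sup>2 - 2 / 5 * t\<^sup>2 * \<eta>\<^sup>2"
      using fin N by (simp add: pos_divide_le_eq)
    also have "2 / 5 * t\<^sup>2 * \<eta>\<^sup>2 = \<eta> ^ 4 / (1000 * M\<^sup>2)"
      using M0 by (simp add: t_def power_divide power_mult_distrib power4_eq_xxxx power2_eq_square)
    finally show ?thesis .
  qed
  ultimately show ?thesis unfolding a_def by blast
qed

section \<open>Orthogonality and almost maximal vectors\<close>

text \<open>Apply orthogonality to \<open>c = - t cnj u\<close> and choose a unit vector \<open>y\<close> at which \<open>T + cA\<close> almost
  attains its norm, with an error \<open>t\<^sup>2\<close> of second order. Expanding \<open>\<parallel>(T + cA)y\<parallel>\<^sup>2\<close> bounds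
  \<open>norm_defect T y + 2 t Re (u f(y))\<close> by \<open>2 t \<epsilon> \<parallel>T\<parallel> \<parallel>A\<parallel> + O(t\<^sup>2)\<close>. Dropping the nonnegative defect
  and dividing by \<open>t\<close> gives one claim; bounding \<open>Re (u f(y))\<close> from below gives the other.\<close>

lemma approx_BJ_orthogonal_ex_near_maximal_Re_le:
  fixes T A :: "('a::complex_inner, 'b::complex_inner) cblinfun"
  assumes nonzero: "(UNIV :: 'a set) \<noteq> {0}" and BJ: "approx_BJ_orthogonal \<epsilon> T A"
    and u: "cmod u = 1" and d: "0 < d"
  shows "\<exists>y. norm y = 1 \<and> norm_defect T y \<le> d \<and>
    Re (u * cinner (cblinfun_apply T y) (cblinfun_apply A y)) \<le> \<epsilon> * norm T * norm A + d"
proof -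
  define M where "M = norm T * norm A"
  define K where "K = 2 * \<bar>\<epsilon>\<bar> * M + 1 + (norm A)\<^sup>2 + 2 * M"
  have M0: "0 \<le> M" by (simp add: M_def)
  then have eM: "0 \<le> \<bar>\<epsilon>\<bar> * M" by simp
  have K: "1 \<le> K" "1 + (norm A)\<^sup>2 \<le> K"
    using M0 eM zero_le_power2[of "norm A"] unfolding K_def by linarith+
  define t where "t = min 1 (d / K)"
  have t: "0 < t" "t \<le> 1" "t * K \<le> d"
    using d K by (auto simp: t_def min_def field_simps)
  define c where "c = - (complex_of_real t * cnj u)"
  have c: "cmod c = t" using t u by (simp add: c_def norm_mult)
  obtain y where y: "norm y = 1"
    and ygt: "(norm (T + c *\<^sub>C A))\<^sup>2 - t\<^sup>2 < (norm (cblinfun_apply (T + c *\<^sub>C A) y))\<^sup>2"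
    using ex_unit_vector_norm_sq_gt[OF nonzero, of "t\<^sup>2" "T + c *\<^sub>C A"] t by auto
  define g where "g = Re (u * cinner (cblinfun_apply T y) (cblinfun_apply A y))"
  have "(norm (cblinfun_apply (T + c *\<^sub>C A) y))\<^sup>2
      = (norm (cblinfun_apply T y))\<^sup>2 - 2 * t * g + t\<^sup>2 * (norm (cblinfun_apply A y))\<^sup>2"
    unfolding plus_cblinfun.rep_eq scaleC_cblinfun.rep_eq norm_add_scaleC_sq c
    by (simp add: c_def g_def algebra_simps)
  moreover have "t\<^sup>2 * (norm (cblinfun_apply A y))\<^sup>2 \<le> t\<^sup>2 * (norm A)\<^sup>2"
    using norm_cblinfun_apply[of A y] y by (intro mult_left_mono power_mono) auto
  moreover have "(norm T)\<^sup>2 - 2 * \<epsilon> * M * t \<le> (norm (T + c *\<^sub>C A))\<^sup>2"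
    using BJ[unfolded approx_BJ_orthogonal_def, rule_format, of c]
    by (simp add: norm_scaleC c M_def mult_ac)
  ultimately have main: "norm_defect T y + 2 * t * g \<le> 2 * \<epsilon> * M * t + t\<^sup>2 * (1 + (norm A)\<^sup>2)"
    using ygt y by (simp add: norm_defect_def algebra_simps)
  have "t * (2 * g) \<le> t * (2 * \<epsilon> * M + t * (1 + (norm A)\<^sup>2))"
    using main norm_defect_nonneg[of T y] by (simp add: power2_eq_square algebra_simps)
  then have "2 * g \<le> 2 * \<epsilon> * M + t * (1 + (norm A)\<^sup>2)"
    using t by simp
  also have "t * (1 + (norm A)\<^sup>2) \<le> d"
    using mult_left_mono[OF K(2), of t] t by linarith
  finally have g: "g \<le> \<epsilon> * M + d" using d by simp
  have "\<bar>g\<bar> \<le> M"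
    using abs_Re_le_cmod[of "u * cinner (cblinfun_apply T y) (cblinfun_apply A y)"]
      cmod_cinner_cblinfun_le[of T y A y] u y by (simp add: g_def M_def norm_mult)
  then have "t * (- g) \<le> t * M" using t by (intro mult_left_mono) auto
  moreover have "(\<epsilon> * M) * t \<le> (\<bar>\<epsilon>\<bar> * M) * t"
    using t M0 by (intro mult_right_mono) auto
  moreover have "t\<^sup>2 * (1 + (norm A)\<^sup>2) \<le> t * (1 + (norm A)\<^sup>2)"
    using t by (intro mult_right_mono) (auto simp: power2_eq_square mult_left_le)
  ultimately have "norm_defect T y \<le> t * K"
    using main unfolding K_def by (simp add: algebra_simps)
  with g t y show ?thesis
    unfolding g_def M_def by (intro exI[of _ y]) (auto simp: mult.assoc)
qed

text \<open>Otherwise \<open>\<bar>f\<bar>\<close> exceeds \<open>\<epsilon> \<parallel>T\<parallel> \<parallel>A\<parallel> + d\<close> on all unit vectors of defect at most \<open>d\<close>, and each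
  of them admits a descent step. A step multiplies the admissible defect by 16, so \<open>k\<close> steps
  have to start from a defect that is smaller by the factor \<open>16\<^sup>k\<close>; this is why the induction
  is over all bounds on the defect at once.\<close>

lemma approx_BJ_orthogonal_ex_near_maximal_cmod_le:
  fixes T A :: "('a::complex_inner, 'b::complex_inner) cblinfun"
  assumes nonzero: "(UNIV :: 'a set) \<noteq> {0}" and BJ: "approx_BJ_orthogonal \<epsilon> T A"
    and eps: "0 \<le> \<epsilon>" and d: "0 < d"
  shows "\<exists>x. norm x = 1 \<and> norm_defect T x \<le> d \<and>
    cmod (cinner (cblinfun_apply T x) (cblinfun_apply A x)) \<le> \<epsilon> * norm T * norm A + d"
proof (rule ccontr)
  assume contra: "\<not> ?thesis"
  define f where "f = (\<lambda>x. cinner (cblinfun_apply T x) (cblinfun_apply A x))"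
  define r where "r = \<epsilon> * norm T * norm A"
  define M where "M = norm T * norm A"
  define \<kappa> where "\<kappa> = (d / 2) ^ 4 / (1000 * M\<^sup>2)"
  have r: "0 \<le> r" using eps by (simp add: r_def)
  have far: "r + d < cmod (f x)" if "norm x = 1" "norm_defect T x \<le> d" for x
    using contra that unfolding f_def r_def by (meson not_less)
  have ex_near_maximal: "\<exists>y. norm y = 1 \<and> norm_defect T y \<le> e \<and> Re (u * f y) \<le> r + e"
    if "cmod u = 1" "0 < e" for u e
    using approx_BJ_orthogonal_ex_near_maximal_Re_le[OF nonzero BJ that] by (simp add: f_def r_def)
  have fM: "cmod (f x) \<le> M" if "norm x = 1" for x
    using cmod_cinner_cblinfun_le[of T x A x] that by (simp add: f_def M_def)
  have M0: "0 < M"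
    using ex_near_maximal[of 1 d] d far fM r by (smt (verit) norm_one)
  have iter: "\<exists>x. norm x = 1 \<and> norm_defect T x \<le> e \<and> (cmod (f x))\<^sup>2 \<le> M\<^sup>2 - real k * \<kappa>"
    if "0 < e" for k e
    using that
  proof (induction k arbitrary: e)
    case 0
    then obtain y where "norm y = 1" "norm_defect T y \<le> e" using ex_near_maximal[of 1 e] by auto
    then show ?case using fM[of y] by (intro exI[of _ y]) (auto intro: power_mono)
  next
    case (Suc k)
    \<comment> \<open>The bound \<open>d / 2\<close> leaves a gap of \<open>d / 2\<close> between \<open>Re (u f(y)) \<le> r + e'\<close>
      and \<open>\<bar>f(x)\<bar> > r + d\<close>.\<close>
    define e' where "e' = min (e / 16) (d / 2)"
    have e': "0 < e'" "16 * e' \<le> e" "e' \<le> d / 2" using Suc.prems d by (auto simp: e'_def)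
    from Suc.IH[OF e'(1)] obtain x where x: "norm x = 1" "norm_defect T x \<le> e'"
      "(cmod (f x))\<^sup>2 \<le> M\<^sup>2 - real k * \<kappa>" by blast
    have fx: "r + d < cmod (f x)" using far[OF x(1)] x(2) e' d by simp
    define u where "u = cnj (sgn (f x))"
    have "f x \<noteq> 0" using fx r d by auto
    then have u: "cmod u = 1" "u * f x = complex_of_real (cmod (f x))"
      by (simp_all add: u_def norm_sgn cnj_sgn_mult_self)
    obtain y where y: "norm y = 1" "norm_defect T y \<le> e'" "Re (u * f y) \<le> r + e'"
      using ex_near_maximal[OF u(1) e'(1)] by blast
    obtain v where v: "norm v = 1" "norm_defect T v \<le> 16 * e'"
      "(cmod (f v))\<^sup>2 \<le> (cmod (f x))\<^sup>2 - \<kappa>"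
      using numerical_value_descent[OF x(1) y(1) x(2) y(2) u(1), of A "d / 2" M]
        u(2) y(3) fx d e' r by (auto simp: f_def M_def \<kappa>_def)
    then show ?case using x(3) e' by (intro exI[of _ v]) (auto simp: algebra_simps)
  qed
  have "0 < \<kappa>" using M0 d by (simp add: \<kappa>_def)
  then obtain k where "M\<^sup>2 < real k * \<kappa>" using reals_Archimedean3 by blast
  moreover obtain x where "(cmod (f x))\<^sup>2 \<le> M\<^sup>2 - real k * \<kappa>" using iter[OF d] by blast
  moreover have "0 \<le> (cmod (f x))\<^sup>2" by simp
  ultimately show False by linarith
qed

theorem theorem5p1:
  fixes T A :: "('h::chilbert_space, 'h) cblinfun" and \<epsilon> :: real
  assumes separable: "separable_space (euclidean :: 'h topology)"
    and nonzero: "(UNIV :: 'h set) \<noteq> {0}"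
    and eps: "0 \<le> \<epsilon>" "\<epsilon> < 1"
  shows "approx_BJ_orthogonal \<epsilon> T A \<longleftrightarrow>
    (\<exists>x :: nat \<Rightarrow> 'h.
       (\<forall>n. norm (x n) = 1) \<and>
       (\<lambda>n. norm (cblinfun_apply T (x n))) \<longlonglongrightarrow> norm T \<and>
       (\<exists>L::real.
          (\<lambda>n. cmod (cinner (cblinfun_apply T (x n)) (cblinfun_apply A (x n)))) \<longlonglongrightarrow> L \<and>
          L \<le> \<epsilon> * norm T * norm A))"
proof
  assume BJ: "approx_BJ_orthogonal \<epsilon> T A"
  define f where "f = (\<lambda>x. cmod (cinner (cblinfun_apply T x) (cblinfun_apply A x)))"
  define d where "d = (\<lambda>n. inverse (real (Suc n)))"
  have d_lim: "d \<longlonglongrightarrow> 0"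
    unfolding d_def by (rule LIMSEQ_inverse_real_of_nat)
  have "\<forall>n. \<exists>x. norm x = 1 \<and> norm_defect T x \<le> d n \<and> f x \<le> \<epsilon> * norm T * norm A + d n"
    unfolding f_def d_def
    using approx_BJ_orthogonal_ex_near_maximal_cmod_le[OF nonzero BJ eps(1)] by simp
  then obtain z where z: "\<And>n. norm (z n) = 1" "\<And>n. norm_defect T (z n) \<le> d n"
    "\<And>n. f (z n) \<le> \<epsilon> * norm T * norm A + d n"
    by metis
  have "(\<lambda>n. norm_defect T (z n)) \<longlonglongrightarrow> 0"
    by (rule tendsto_sandwich[OF _ _ tendsto_const d_lim]) (auto simp: norm_defect_nonneg z)
  then have "(\<lambda>n. sqrt ((norm T)\<^sup>2 - norm_defect T (z n))) \<longlonglongrightarrow> sqrt ((norm T)\<^sup>2 - 0)"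
    by (intro tendsto_intros)
  then have T_lim: "(\<lambda>n. norm (cblinfun_apply T (z n))) \<longlonglongrightarrow> norm T"
    by (simp add: norm_defect_def z)
  have "\<forall>n. f (z n) \<in> {0..norm T * norm A}"
    using cmod_cinner_cblinfun_le[of T "z n" A "z n" for n] by (simp add: f_def z)
  then obtain L \<sigma> where \<sigma>: "strict_mono \<sigma>" "((\<lambda>n. f (z n)) \<circ> \<sigma>) \<longlonglongrightarrow> L"
    using compact_Icc[of 0 "norm T * norm A"] unfolding compact_def by meson
  have "L \<le> \<epsilon> * norm T * norm A + 0"
  proof (rule tendsto_le[OF sequentially_bot _ \<sigma>(2)])
    show "(\<lambda>n. \<epsilon> * norm T * norm A + (d \<circ> \<sigma>) n) \<longlonglongrightarrow> \<epsilon> * norm T * norm A + 0"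
      by (intro tendsto_intros LIMSEQ_subseq_LIMSEQ[OF d_lim \<sigma>(1)])
  qed (simp add: z)
  with \<sigma> z T_lim[THEN LIMSEQ_subseq_LIMSEQ, OF \<sigma>(1)] show "\<exists>x :: nat \<Rightarrow> 'h.
       (\<forall>n. norm (x n) = 1) \<and>
       (\<lambda>n. norm (cblinfun_apply T (x n))) \<longlonglongrightarrow> norm T \<and>
       (\<exists>L::real.
          (\<lambda>n. cmod (cinner (cblinfun_apply T (x n)) (cblinfun_apply A (x n)))) \<longlonglongrightarrow> L \<and>
          L \<le> \<epsilon> * norm T * norm A)"
    by (intro exI[of _ "z \<circ> \<sigma>"]) (auto simp: f_def o_def)
next
  assume "\<exists>x :: nat \<Rightarrow> 'h.
       (\<forall>n. norm (x n) = 1) \<and>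
       (\<lambda>n. norm (cblinfun_apply T (x n))) \<longlonglongrightarrow> norm T \<and>
       (\<exists>L::real.
          (\<lambda>n. cmod (cinner (cblinfun_apply T (x n)) (cblinfun_apply A (x n)))) \<longlonglongrightarrow> L \<and>
          L \<le> \<epsilon> * norm T * norm A)"
  then obtain x L where x: "\<And>n. norm (x n) = 1"
    and T_lim: "(\<lambda>n. norm (cblinfun_apply T (x n))) \<longlonglongrightarrow> norm T"
    and L_lim: "(\<lambda>n. cmod (cinner (cblinfun_apply T (x n)) (cblinfun_apply A (x n)))) \<longlonglongrightarrow> L"
    and L: "L \<le> \<epsilon> * norm T * norm A"
    by blast
  show "approx_BJ_orthogonal \<epsilon> T A"
    unfolding approx_BJ_orthogonal_def
  proof
    fix c :: complex
    have "(norm T)\<^sup>2 - 2 * cmod c * L \<le> (norm (T + c *\<^sub>C A))\<^sup>2"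
    proof (rule LIMSEQ_le_const2)
      show "(\<lambda>n. (norm (cblinfun_apply T (x n)))\<^sup>2
          - 2 * cmod c * cmod (cinner (cblinfun_apply T (x n)) (cblinfun_apply A (x n))))
          \<longlonglongrightarrow> (norm T)\<^sup>2 - 2 * cmod c * L"
        by (intro tendsto_intros T_lim L_lim)
      have "(norm (cblinfun_apply T (x n)))\<^sup>2
          - 2 * cmod c * cmod (cinner (cblinfun_apply T (x n)) (cblinfun_apply A (x n)))
          \<le> (norm (T + c *\<^sub>C A))\<^sup>2" for n
      proof -
        define p where "p = cnj c * cinner (cblinfun_apply T (x n)) (cblinfun_apply A (x n))"
        have "cmod p = cmod c * cmod (cinner (cblinfun_apply T (x n)) (cblinfun_apply A (x n)))"
          by (simp add: p_def norm_mult)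
        moreover have "- cmod p \<le> Re p" using abs_Re_le_cmod[of p] by linarith
        moreover have "0 \<le> (cmod c)\<^sup>2 * (norm (cblinfun_apply A (x n)))\<^sup>2" by simp
        moreover have "(norm (cblinfun_apply (T + c *\<^sub>C A) (x n)))\<^sup>2
            = (norm (cblinfun_apply T (x n)))\<^sup>2 + 2 * Re p
              + (cmod c)\<^sup>2 * (norm (cblinfun_apply A (x n)))\<^sup>2"
          unfolding plus_cblinfun.rep_eq scaleC_cblinfun.rep_eq norm_add_scaleC_sq p_def by simp
        moreover have "(norm (cblinfun_apply (T + c *\<^sub>C A) (x n)))\<^sup>2 \<le> (norm (T + c *\<^sub>C A))\<^sup>2"
          using norm_cblinfun_apply[of "T + c *\<^sub>C A" "x n"] x by (intro power_mono) auto
        ultimately show ?thesis by linarith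
      qed
      then show "\<exists>N. \<forall>n\<ge>N. (norm (cblinfun_apply T (x n)))\<^sup>2
          - 2 * cmod c * cmod (cinner (cblinfun_apply T (x n)) (cblinfun_apply A (x n)))
          \<le> (norm (T + c *\<^sub>C A))\<^sup>2" by blast
    qed
    moreover have "cmod c * L \<le> cmod c * (\<epsilon> * norm T * norm A)"
      using L by (intro mult_left_mono) auto
    ultimately show "(norm T)\<^sup>2 - 2 * \<epsilon> * norm T * norm (c *\<^sub>C A) \<le> (norm (T + c *\<^sub>C A))\<^sup>2"
      by (simp add: norm_scaleC mult_ac)
  qed
qed

end
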